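(* Let $\sigma>0$ and $w^0=(y^0,z^0,x^0)\in\mathbb R^{M_3}\times\mathbb R^N\times\mathbb R^N$. Let $\{\bar w^k\}=\{(\bar y^k,\bar z^k,\bar x^k)\}_{k\ge0}$ be the sequence generated by the HOT algorithm (defined in the context), let $w^*=(y^*,z^*,x^* )$ be the limit point of this sequence, and let $R_0=\|x^0-x^*+\sigma(z^0-z^* )\|$. Then for all $k\ge0$, $$\|\mathcal R(\bar w^k)\|\le\Big(\frac{\sigma+1}{\sigma}\Big)\frac{R_0}{k+1}$$ and $$-\|z^*\|\frac{R_0}{k+1}\le\langle c,\bar x^k-x^*\rangle\le(\sigma\|z^*\|+R_0)\frac{R_0}{\sigma(k+1)}.$$
   Context: Let $m,n$ be positive integers, $M=mn$, $M_3=3M-1$, $N=m^2n+mn^2$. Let $\mu^1,\mu^2\in\mathbb R^M$ be nonnegative vectors whose entries each sum to $1$ (histograms on an $m\times n$ grid, vectorized with the row index running fastest). $\mathbf 1_p$ is the all-ones vector in $\mathbb R^p$, $I_p$ the identity, $\otimes$ the Kronecker product, and $\bar I_p=[I_{p-1},\mathbf 0_{p-1}]\in\mathbb R^{(p-1)\times p}$. Define $A=\begin{bmatrix} A_1 & A_2 \\ A_3 & \mathbf 0 \\ \mathbf 0 & A_4 \end{bmatrix}\in\mathbb R^{M_3\times N}$ with $A_1=I_M\otimes\mathbf 1_m^\top\in\mathbb R^{M\times m^2n}$, $A_2=-\mathbf 1_n^\top\otimes I_M\in\mathbb R^{M\times mn^2}$, $A_3=I_n\otimes(\mathbf 1_m^\top\otimes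 I_m)\in\mathbb R^{M\times m^2n}$, and $A_4=\operatorname{diag}(\mathbf 1_n^\top\otimes I_m,\dots,\mathbf 1_n^\top\otimes I_m,\mathbf 1_n^\top\otimes\bar I_m)\in\mathbb R^{(M-1)\times mn^2}$ (block diagonal with $n$ blocks). The matrix $A$ has full row rank. Let $b=[\mathbf 0_M;\mu^1;\bar I_M\mu^2]\in\mathbb R^{M_3}$. Let $c=[c^1;c^2]\in\mathbb R^{m^2n}\times\mathbb R^{mn^2}$, where $c^1$ has entries $c^{(1)}_{i,k,j}=(k-i)^2$ ($1\le i,k\le m$, $1\le j\le n$, ordered with $i$ fastest, then $k$, then $j$) and $c^2$ has entries $c^{(2)}_{k,j,l}=(j-l)^2$ ($1\le k\le m$, $1\le j,l\le n$, ordered with $k$ fastest, then $j$, then $l$). Primal problem: $\min\{\langle c,x\rangle : Ax=b,\ x\in\mathbb R^N_+\}$. Dual problem: $\min\{-\langle b,y\rangle+\delta_{\mathbb R^N_+}(z): A^\top y+z=c\}$, where $\delta_C$ is the indicator function of $C$. The KKT residual mapping is, for $w=(y,z,x)$, $$\mathcal R(w)=\begin{pmatrix}b-Ax\\ z-\Pi_{\mathbb R^N_+}(z-x)\\ c-A^\top y-z\end{pmatrix},$$ with $\Pi_{\mathbb R^N_+}$ the Euclidean projection onto $\mathbb R^N_+$; $\|\cdot\|$ is the Euclidean norm. For $\sigma>0$, $L_\sigma(y,z;x)=-\langle b,y\rangle+\delta_{\mathbb R^N_+}(z)+\frac\sigma2\|A^\top y+z-c+\frac1\sigma x\|^2-\frac1{2\sigma}\|x\|^2$.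 HOT algorithm: given $\sigma>0$ and $w^0=(y^0,z^0,x^0)$, for $k=0,1,2,\dots$ set $\bar y^k=\arg\min_{y\in\mathbb R^{M_3}}L_\sigma(y,z^k;x^k)$; $\bar x^k=x^k+\sigma(A^\top\bar y^k+z^k-c)$; $\bar z^k=\arg\min_{z\in\mathbb R^N}L_\sigma(\bar y^k,z;\bar x^k)$; and, with $w^k=(y^k,z^k,x^k)$, $\bar w^k=(\bar y^k,\bar z^k,\bar x^k)$, $w^{k+1}=\frac1{k+2}w^0+\frac{k+1}{k+2}(2\bar w^k-w^k)$. It is known that $\{\bar w^k\}$ converges to a point $w^*=(y^*,z^*,x^* )$ with $(y^*,z^* )$ a dual solution and $x^*$ a primal solution. *)

theory Defs
  imports Complex_Main "HOL-Library.Extended_Real" "Jordan_Normal_Form.Matrix"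
begin

section \<open>Euclidean space, orthant, projection\<close>

definition vnorm :: "real vec \<Rightarrow> real" where
  "vnorm v = sqrt (v \<bullet> v)"

definition vec_converges :: "nat \<Rightarrow> (nat \<Rightarrow> real vec) \<Rightarrow> real vec \<Rightarrow> bool" where
  "vec_converges d f v \<longleftrightarrow>
     v \<in> carrier_vec d \<and> (\<forall>k. f k \<in> carrier_vec d) \<and> (\<lambda>k. vnorm (f k - v)) \<longlonglongrightarrow> 0"

definition nonneg_orthant :: "nat \<Rightarrow> real vec set" where
  "nonneg_orthant d = {v \<in> carrier_vec d. \<forall>i<d. 0 \<le> v $ i}"

definition indicator_fun :: "'a set \<Rightarrow> 'a \<Rightarrow> ereal" where
  "indicator_fun C v = (if v \<in> C then 0 else \<infinity>)"

definition proj :: "real vec set \<Rightarrow> real vec \<Rightarrow> real vec" where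
  "proj C v = arg_min (\<lambda>p. vnorm (v - p)) (\<lambda>p. p \<in> C)"

section \<open>Problem data\<close>

definition kron :: "real mat \<Rightarrow> real mat \<Rightarrow> real mat" where
  "kron P Q = mat (dim_row P * dim_row Q) (dim_col P * dim_col Q)
     (\<lambda>(i, j). P $$ (i div dim_row Q, j div dim_col Q) * Q $$ (i mod dim_row Q, j mod dim_col Q))"

text \<open>The row vector of ones, as a matrix with one row.\<close>

definition ones_row :: "nat \<Rightarrow> real mat" where
  "ones_row p = mat 1 p (\<lambda>_. 1)"

text \<open>The identity with its last row removed.\<close>

definition Ibar :: "nat \<Rightarrow> real mat" where
  "Ibar p = mat (p - 1) p (\<lambda>(i, j). if i = j then 1 else 0)"

definition rowdim :: "nat \<Rightarrow> nat \<Rightarrow> nat" where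
  "rowdim m n = 3 * (m * n) - 1"

definition coldim :: "nat \<Rightarrow> nat \<Rightarrow> nat" where
  "coldim m n = m^2 * n + m * n^2"

definition A1 :: "nat \<Rightarrow> nat \<Rightarrow> real mat" where
  "A1 m n = kron (1\<^sub>m (m * n)) (ones_row m)"

definition A2 :: "nat \<Rightarrow> nat \<Rightarrow> real mat" where
  "A2 m n = - kron (ones_row n) (1\<^sub>m (m * n))"

definition A3 :: "nat \<Rightarrow> nat \<Rightarrow> real mat" where
  "A3 m n = kron (1\<^sub>m n) (kron (ones_row m) (1\<^sub>m m))"

definition A4 :: "nat \<Rightarrow> nat \<Rightarrow> real mat" where
  "A4 m n = diag_block_mat
     (replicate (n - 1) (kron (ones_row n) (1\<^sub>m m)) @ [kron (ones_row n) (Ibar m)])"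

definition A_mat :: "nat \<Rightarrow> nat \<Rightarrow> real mat" where
  "A_mat m n = four_block_mat
     (A1 m n)                                    (A2 m n)
     (A3 m n @\<^sub>r 0\<^sub>m (m * n - 1) (m^2 * n))   (0\<^sub>m (m * n) (m * n^2) @\<^sub>r A4 m n)"

definition b_vec :: "nat \<Rightarrow> nat \<Rightarrow> real vec \<Rightarrow> real vec \<Rightarrow> real vec" where
  "b_vec m n \<mu>1 \<mu>2 = 0\<^sub>v (m * n) @\<^sub>v \<mu>1 @\<^sub>v (Ibar (m * n) *\<^sub>v \<mu>2)"

text \<open>
  Indices are 0-based, which leaves the differences of indices unchanged. The entry (i, k, j) of the
  first cost block sits at position i + m * (k + m * j), the entry (k, j, l) of the second one
  at position k + m * (j + n * l).
\<close>

definition c1_vec :: "nat \<Rightarrow> nat \<Rightarrow> real vec" where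
  "c1_vec m n = vec (m^2 * n) (\<lambda>t. (real ((t div m) mod m) - real (t mod m))^2)"

definition c2_vec :: "nat \<Rightarrow> nat \<Rightarrow> real vec" where
  "c2_vec m n = vec (m * n^2) (\<lambda>t. (real ((t div m) mod n) - real (t div (m * n)))^2)"

definition c_vec :: "nat \<Rightarrow> nat \<Rightarrow> real vec" where
  "c_vec m n = c1_vec m n @\<^sub>v c2_vec m n"

definition histogram :: "nat \<Rightarrow> real vec \<Rightarrow> bool" where
  "histogram d \<mu> \<longleftrightarrow> \<mu> \<in> nonneg_orthant d \<and> (\<Sum>i<d. \<mu> $ i) = 1"

section \<open>KKT residual, augmented Lagrangian, algorithm\<close>

definition KKT_res ::
  "nat \<Rightarrow> nat \<Rightarrow> real vec \<Rightarrow> real vec \<Rightarrow> real vec \<Rightarrow> real vec \<Rightarrow> real vec \<Rightarrow> real vec" where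
  "KKT_res m n \<mu>1 \<mu>2 y z x =
     (b_vec m n \<mu>1 \<mu>2 - A_mat m n *\<^sub>v x)
     @\<^sub>v (z - proj (nonneg_orthant (coldim m n)) (z - x))
     @\<^sub>v (c_vec m n - (A_mat m n)\<^sup>T *\<^sub>v y - z)"

text \<open>The augmented Lagrangian without the indicator function of the orthant.\<close>

definition aug_lag_smooth ::
  "nat \<Rightarrow> nat \<Rightarrow> real vec \<Rightarrow> real vec \<Rightarrow> real \<Rightarrow> real vec \<Rightarrow> real vec \<Rightarrow> real vec \<Rightarrow> real" where
  "aug_lag_smooth m n \<mu>1 \<mu>2 \<sigma> y z x =
     - (b_vec m n \<mu>1 \<mu>2 \<bullet> y)
     + \<sigma> / 2 * (vnorm ((A_mat m n)\<^sup>T *\<^sub>v y + z - c_vec m n + (1 / \<sigma>) \<cdot>\<^sub>v x))^2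
     - 1 / (2 * \<sigma>) * (vnorm x)^2"

definition aug_lag ::
  "nat \<Rightarrow> nat \<Rightarrow> real vec \<Rightarrow> real vec \<Rightarrow> real \<Rightarrow> real vec \<Rightarrow> real vec \<Rightarrow> real vec \<Rightarrow> ereal" where
  "aug_lag m n \<mu>1 \<mu>2 \<sigma> y z x =
     ereal (aug_lag_smooth m n \<mu>1 \<mu>2 \<sigma> y z x) + indicator_fun (nonneg_orthant (coldim m n)) z"

definition halpern_update :: "nat \<Rightarrow> real vec \<Rightarrow> real vec \<Rightarrow> real vec \<Rightarrow> real vec" where
  "halpern_update k u0 u ub =
     (1 / real (k + 2)) \<cdot>\<^sub>v u0 + (real (k + 1) / real (k + 2)) \<cdot>\<^sub>v (2 \<cdot>\<^sub>v ub - u)"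

text \<open>
  The sequences y, z, x are the iterates and yb, zb, xb the barred ones. The iterate z k may
  have negative entries (also for k > 0, because of the reflection step), and then the augmented
  Lagrangian is identically infinite in y. The y-step therefore minimizes the
  augmented Lagrangian without the indicator term, which does not depend on y; for nonnegative z k
  the minimizers are the same.
\<close>

definition HOT_sequence ::
  "nat \<Rightarrow> nat \<Rightarrow> real vec \<Rightarrow> real vec \<Rightarrow> real \<Rightarrow> real vec \<Rightarrow> real vec \<Rightarrow> real vec \<Rightarrow>
   (nat \<Rightarrow> real vec) \<Rightarrow> (nat \<Rightarrow> real vec) \<Rightarrow> (nat \<Rightarrow> real vec) \<Rightarrow>
   (nat \<Rightarrow> real vec) \<Rightarrow> (nat \<Rightarrow> real vec) \<Rightarrow> (nat \<Rightarrow> real vec) \<Rightarrow> bool" where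
  "HOT_sequence m n \<mu>1 \<mu>2 \<sigma> y0 z0 x0 y z x yb zb xb \<longleftrightarrow>
     y 0 = y0 \<and> z 0 = z0 \<and> x 0 = x0 \<and>
     (\<forall>k.
        is_arg_min (\<lambda>v. aug_lag_smooth m n \<mu>1 \<mu>2 \<sigma> v (z k) (x k))
          (\<lambda>v. v \<in> carrier_vec (rowdim m n)) (yb k) \<and>
        xb k = x k + \<sigma> \<cdot>\<^sub>v ((A_mat m n)\<^sup>T *\<^sub>v yb k + z k - c_vec m n) \<and>
        is_arg_min (\<lambda>v. aug_lag m n \<mu>1 \<mu>2 \<sigma> (yb k) v (xb k))
          (\<lambda>v. v \<in> carrier_vec (coldim m n)) (zb k) \<and>
        y (Suc k) = halpern_update k y0 (y k) (yb k) \<and>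
        z (Suc k) = halpern_update k z0 (z k) (zb k) \<and>
        x (Suc k) = halpern_update k x0 (x k) (xb k))"

end

theory Submission
  imports Defs "HOL-Analysis.L2_Norm"
begin

text \<open>
  Put $v^k = x^k + \sigma z^k$ and $\bar v^k = \bar x^k + \sigma \bar z^k$. The map $v^k \mapsto \bar v^k$ is
  firmly nonexpansive, and $v^k - \bar v^k = -\sigma s^k$ with the slack
  $s^k = A^T \bar y^k + \bar z^k - c$. The Halpern iteration therefore satisfies
  $(k+1) \|v^k - \bar v^k\|^2 \le \langle v^k - \bar v^k, v^0 - \bar v^k\rangle$ for all $k$,
  an estimate that involves no fixed point. As $\bar v^k$ converges, the slack tends to $0$, so the limit
  is a KKT point. Firm nonexpansiveness against the limit then gives
  $\sigma \|s^k\| \le R_0/(k+1)$ and $\|\bar v^k - v^*\| \le R_0$. The two minimization steps give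
  $A \bar x^k = b$ and the complementarity of $\bar z^k \ge 0$ and $\bar x^k + \sigma s^k \ge 0$, so the KKT
  residual and the objective gap are controlled by $\|s^k\|$.
\<close>

section \<open>Halpern iteration\<close>

lemma sum_mult_le_L2_set: "(\<Sum>i\<in>I. f i * g i) \<le> L2_set f I * L2_set g I"
proof -
  have "(\<Sum>i\<in>I. f i * g i) \<le> (\<Sum>i\<in>I. \<bar>f i\<bar> * \<bar>g i\<bar>)"
    by (intro sum_mono) (metis abs_ge_self abs_mult)
  then show ?thesis
    using L2_set_mult_ineq[of f g I] by linarith
qed

lemma L2_set_power2: "(L2_set f I)\<^sup>2 = (\<Sum>i\<in>I. (f i)\<^sup>2)"
  by (simp add: L2_set_def sum_nonneg)

lemma L2_set_uminus [simp]: "L2_set (\<lambda>i. - f i) I = L2_set f I"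
  by (simp add: L2_set_def)

text \<open>Turns a quadratic estimate, after Cauchy-Schwarz, into a rate by cancelling one factor
  \<open>q\<close>; the case \<open>q = 0\<close> is split off because cancellation needs
  \<open>q > 0\<close>.\<close>

lemma le_divide_if_mult_power2_le:
  fixes a q r :: real
  assumes "a * q\<^sup>2 \<le> q * r" "0 < a" "0 \<le> q" "0 \<le> r"
  shows "q \<le> r / a"
proof (cases "q = 0")
  case False
  then have "q * (a * q) \<le> q * r" "0 < q"
    using assms by (simp_all add: power2_eq_square mult.left_commute)
  then have "a * q \<le> r"
    by simp
  then show ?thesis
    using assms(2) by (simp add: field_simps)
qed (use assms in simp)

text \<open>Induction step for \<open>residual_potential\<close>. There \<open>q\<close> and
  \<open>q'\<close> are consecutive residuals, \<open>a\<close> and \<open>a'\<close> the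
  differences between the anchor and the barred points, and \<open>t\<close> is
  \<open>k + 1\<close>.\<close>

lemma halpern_step:
  fixes a a' q q' :: "'i \<Rightarrow> real" and t :: real
  assumes firm: "0 \<le> (\<Sum>i\<in>I. (a i - a' i) * (q' i - q i))"
    and step: "\<And>i. i \<in> I \<Longrightarrow> (t + 1) * (a' i - q' i) = t * (a i + q i)"
    and IH: "t * (\<Sum>i\<in>I. (q i)\<^sup>2) \<le> (\<Sum>i\<in>I. q i * a i)"
    and "0 \<le> t"
  shows "(t + 1) * (\<Sum>i\<in>I. (q' i)\<^sup>2) \<le> (\<Sum>i\<in>I. q' i * a' i)"
proof -
  have pos: "0 < t + 1"
    using \<open>0 \<le> t\<close> by simp
  have a': "a' i = q' i + t / (t + 1) * (a i + q i)" if "i \<in> I" for i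
  proof -
    have "a' i - q' i = t * (a i + q i) / (t + 1)"
      using step[OF that] pos by (simp add: eq_divide_eq mult.commute)
    then show ?thesis by simp
  qed
  \<comment> \<open>Eliminating \<open>a'\<close> from the firmness term, scaled by
    \<open>t + 1\<close>, splits off the old invariant, which \<open>IH\<close> then
    controls.\<close>
  have "(t + 1) * ((a i - a' i) * (q' i - q i))
      = (q' i * a i + q' i * q i) - (t + 1) * (q' i)\<^sup>2 - (q i * a i - t * (q i)\<^sup>2)" if "i \<in> I" for i
  proof -
    have "(t + 1) * (a i - a' i) = a i - t * q i - (t + 1) * q' i"
      using step[OF that] by (simp add: algebra_simps)
    then have "(t + 1) * ((a i - a' i) * (q' i - q i))
        = (a i - t * q i - (t + 1) * q' i) * (q' i - q i)"
      by (metis mult.assoc)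
    then show ?thesis
      by (simp add: algebra_simps power2_eq_square)
  qed
  then have "(t + 1) * (\<Sum>i\<in>I. (a i - a' i) * (q' i - q i))
      = (\<Sum>i\<in>I. q' i * a i + q' i * q i) - (t + 1) * (\<Sum>i\<in>I. (q' i)\<^sup>2)
        - ((\<Sum>i\<in>I. q i * a i) - t * (\<Sum>i\<in>I. (q i)\<^sup>2))"
    by (simp add: sum_distrib_left sum_subtractf)
  moreover have "0 \<le> (t + 1) * (\<Sum>i\<in>I. (a i - a' i) * (q' i - q i))"
    using firm pos by simp
  ultimately have *: "(t + 1) * (\<Sum>i\<in>I. (q' i)\<^sup>2) \<le> (\<Sum>i\<in>I. q' i * a i + q' i * q i)"
    using IH by linarith
  \<comment> \<open>By the formula for \<open>a'\<close>, the new right-hand side is one copy of the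
    squared residual plus \<open>t / (t + 1)\<close> times the sum bounded below in
    \<open>*\<close>; the latter yields the other \<open>t\<close> copies.\<close>
  have "(\<Sum>i\<in>I. q' i * a' i)
      = (\<Sum>i\<in>I. (q' i)\<^sup>2) + t / (t + 1) * (\<Sum>i\<in>I. q' i * a i + q' i * q i)"
    unfolding sum_distrib_left sum.distrib[symmetric]
    by (intro sum.cong) (simp_all add: a' power2_eq_square algebra_simps add_divide_distrib)
  moreover have "t / (t + 1) * ((t + 1) * (\<Sum>i\<in>I. (q' i)\<^sup>2))
      \<le> t / (t + 1) * (\<Sum>i\<in>I. q' i * a i + q' i * q i)"
    using * \<open>0 \<le> t\<close> by (intro mult_left_mono) auto
  moreover have "t / (t + 1) * ((t + 1) * (\<Sum>i\<in>I. (q' i)\<^sup>2)) = t * (\<Sum>i\<in>I. (q' i)\<^sup>2)"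
    using pos by simp
  ultimately show ?thesis
    by (simp add: algebra_simps)
qed

text \<open>The recursion is multiplied by \<open>k + 2\<close> to avoid division. With
  \<open>vb k = T (v k)\<close>, \<open>firm\<close> is firm nonexpansiveness of \<open>T\<close>
  for consecutive iterates; comparison with a limit enters later as \<open>fixpoint\<close>.\<close>

locale halpern =
  fixes I :: "'i set" and v vb :: "nat \<Rightarrow> 'i \<Rightarrow> real"
  assumes step: "\<And>k i. i \<in> I \<Longrightarrow>
      (real k + 2) * v (Suc k) i = v 0 i + (real k + 1) * (2 * vb k i - v k i)"
    and firm: "\<And>k. 0 \<le> (\<Sum>i\<in>I. (vb (Suc k) i - vb k i)
                          * ((v (Suc k) i - vb (Suc k) i) - (v k i - vb k i)))"
begin

text \<open>For \<open>k = 0\<close> both sides agree, and \<open>halpern_step\<close> carries the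
  invariant on. Since no fixed point occurs in it, it is available before the limit is known to be
  optimal.\<close>

lemma residual_potential:
  "(real k + 1) * (\<Sum>i\<in>I. (v k i - vb k i)\<^sup>2) \<le> (\<Sum>i\<in>I. (v k i - vb k i) * (v 0 i - vb k i))"
proof (induction k)
  case 0
  show ?case by (simp add: power2_eq_square)
next
  case (Suc k)
  have "(real k + 1 + 1) * (\<Sum>i\<in>I. (v (Suc k) i - vb (Suc k) i)\<^sup>2)
      \<le> (\<Sum>i\<in>I. (v (Suc k) i - vb (Suc k) i) * (v 0 i - vb (Suc k) i))"
  proof (rule halpern_step[OF _ _ Suc.IH])
    show "0 \<le> (\<Sum>i\<in>I. (v 0 i - vb k i - (v 0 i - vb (Suc k) i))
        * ((v (Suc k) i - vb (Suc k) i) - (v k i - vb k i)))"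
      using firm[of k] by simp
  next
    fix i assume "i \<in> I"
    from step[OF this, of k]
    show "(real k + 1 + 1) * (v 0 i - vb (Suc k) i - (v (Suc k) i - vb (Suc k) i))
        = (real k + 1) * (v 0 i - vb k i + (v k i - vb k i))"
      by (simp add: algebra_simps)
  qed simp
  then show ?case by (simp add: add.commute)
qed

lemma residual_le_dist_iterate:
  "L2_set (\<lambda>i. v k i - vb k i) I \<le> L2_set (\<lambda>i. v 0 i - vb k i) I / (real k + 1)"
  using residual_potential[of k]
    sum_mult_le_L2_set[of "\<lambda>i. v k i - vb k i" "\<lambda>i. v 0 i - vb k i" I]
  by (intro le_divide_if_mult_power2_le) (auto simp: L2_set_power2)

text \<open>The distance from the anchor to the barred points converges, so dividing it by
  \<open>k + 1\<close> gives a null sequence. The limit \<open>vs\<close> need not be known to be a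
  fixed point here.\<close>

lemma residual_tendsto_0:
  assumes "\<And>i. i \<in> I \<Longrightarrow> (\<lambda>k. vb k i) \<longlonglongrightarrow> vs i"
  shows "(\<lambda>k. L2_set (\<lambda>i. v k i - vb k i) I) \<longlonglongrightarrow> 0"
proof (rule tendsto_sandwich[OF _ _ tendsto_const])
  show "(\<lambda>k. L2_set (\<lambda>i. v 0 i - vb k i) I / (real k + 1)) \<longlonglongrightarrow> 0"
  proof (rule tendsto_divide_0)
    show "(\<lambda>k. L2_set (\<lambda>i. v 0 i - vb k i) I) \<longlonglongrightarrow> L2_set (\<lambda>i. v 0 i - vs i) I"
      unfolding L2_set_def using assms by (intro tendsto_intros)
    show "filterlim (\<lambda>k. real k + 1) at_infinity sequentially"
      by (intro filterlim_at_top_imp_at_infinity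
          filterlim_at_top_mono[OF filterlim_real_sequentially]) simp
  qed
qed (use residual_le_dist_iterate in auto)

text \<open>\<open>fixpoint\<close> is firm nonexpansiveness against a point \<open>vs\<close> whose
  own residual is zero.\<close>

context
  fixes vs :: "'i \<Rightarrow> real"
  assumes fixpoint: "\<And>k. 0 \<le> (\<Sum>i\<in>I. (vb k i - vs i) * (v k i - vb k i))"
begin

text \<open>Splitting \<open>v 0 - vb k\<close> as \<open>(v 0 - vs) - (vb k - vs)\<close> in the
  potential, \<open>fixpoint\<close> discards the second part, so the moving distance becomes a
  constant one.\<close>

lemma residual_rate:
  "L2_set (\<lambda>i. v k i - vb k i) I \<le> L2_set (\<lambda>i. v 0 i - vs i) I / (real k + 1)"
proof (rule le_divide_if_mult_power2_le)
  have "(\<Sum>i\<in>I. (v k i - vb k i) * (v 0 i - vb k i))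
      = (\<Sum>i\<in>I. (v k i - vb k i) * (v 0 i - vs i)) - (\<Sum>i\<in>I. (vb k i - vs i) * (v k i - vb k i))"
    by (simp add: algebra_simps sum_subtractf sum.distrib)
  then show "(real k + 1) * (L2_set (\<lambda>i. v k i - vb k i) I)\<^sup>2
      \<le> L2_set (\<lambda>i. v k i - vb k i) I * L2_set (\<lambda>i. v 0 i - vs i) I"
    using residual_potential[of k] fixpoint[of k]
      sum_mult_le_L2_set[of "\<lambda>i. v k i - vb k i" "\<lambda>i. v 0 i - vs i" I]
    by (simp add: L2_set_power2)
qed auto

text \<open>With p = vb - vs and q = v - vb, both claims expand squares: |p - q|^2 = |p + q|^2 -
  4<p, q> and |p|^2 = |p + q|^2 - 2<p, q> - |q|^2, where <p, q> is nonnegative by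
  \<open>fixpoint\<close>.\<close>

lemma
  shows reflected_dist_le: "L2_set (\<lambda>i. 2 * vb k i - v k i - vs i) I \<le> L2_set (\<lambda>i. v k i - vs i) I"
    and bar_dist_le_iterate_dist: "L2_set (\<lambda>i. vb k i - vs i) I \<le> L2_set (\<lambda>i. v k i - vs i) I"
proof -
  have "(\<Sum>i\<in>I. (2 * vb k i - v k i - vs i)\<^sup>2)
      = (\<Sum>i\<in>I. (v k i - vs i)\<^sup>2) - 4 * (\<Sum>i\<in>I. (vb k i - vs i) * (v k i - vb k i))"
    unfolding sum_distrib_left sum_subtractf[symmetric]
    by (intro sum.cong refl) (simp add: power2_eq_square algebra_simps)
  then show "L2_set (\<lambda>i. 2 * vb k i - v k i - vs i) I \<le> L2_set (\<lambda>i. v k i - vs i) I"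
    using fixpoint[of k] by (simp add: L2_set_def)
  have "(\<Sum>i\<in>I. (vb k i - vs i)\<^sup>2) = (\<Sum>i\<in>I. (v k i - vs i)\<^sup>2)
      - 2 * (\<Sum>i\<in>I. (vb k i - vs i) * (v k i - vb k i)) - (\<Sum>i\<in>I. (v k i - vb k i)\<^sup>2)"
    unfolding sum_distrib_left sum_subtractf[symmetric]
    by (intro sum.cong refl) (simp add: power2_eq_square algebra_simps)
  moreover have "0 \<le> (\<Sum>i\<in>I. (v k i - vb k i)\<^sup>2)"
    by (intro sum_nonneg) simp
  ultimately show "L2_set (\<lambda>i. vb k i - vs i) I \<le> L2_set (\<lambda>i. v k i - vs i) I"
    using fixpoint[of k] by (simp add: L2_set_def)
qed

text \<open>Each iterate is a convex combination of the anchor and a reflected point, and by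
  induction both lie in the ball around \<open>vs\<close> through the anchor.\<close>

lemma iterate_dist_le: "L2_set (\<lambda>i. v k i - vs i) I \<le> L2_set (\<lambda>i. v 0 i - vs i) I"
proof (induction k)
  case (Suc k)
  let ?R = "L2_set (\<lambda>i. v 0 i - vs i) I"
  have "(real k + 2) * L2_set (\<lambda>i. v (Suc k) i - vs i) I
      = L2_set (\<lambda>i. (real k + 2) * (v (Suc k) i - vs i)) I"
    by (simp add: L2_set_right_distrib)
  also have "\<dots> = L2_set (\<lambda>i. (v 0 i - vs i) + (real k + 1) * (2 * vb k i - v k i - vs i)) I"
    by (intro L2_set_cong refl) (use step in \<open>simp add: algebra_simps\<close>)
  also have "\<dots> \<le> ?R + L2_set (\<lambda>i. (real k + 1) * (2 * vb k i - v k i - vs i)) I"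
    by (rule L2_set_triangle_ineq)
  also have "\<dots> = ?R + (real k + 1) * L2_set (\<lambda>i. 2 * vb k i - v k i - vs i) I"
    by (simp add: L2_set_right_distrib)
  also have "\<dots> \<le> ?R + (real k + 1) * ?R"
    using reflected_dist_le[of k] Suc.IH by (intro add_left_mono mult_left_mono) auto
  also have "\<dots> = (real k + 2) * ?R"
    by (simp add: algebra_simps)
  finally show ?case
    by (simp add: mult_le_cancel_left)
qed simp

lemma bar_dist_le: "L2_set (\<lambda>i. vb k i - vs i) I \<le> L2_set (\<lambda>i. v 0 i - vs i) I"
  using bar_dist_le_iterate_dist iterate_dist_le order_trans by blast

end

end

section \<open>Vectors and the orthant\<close>

lemma scalar_prod_sum: "w \<in> carrier_vec d \<Longrightarrow> v \<bullet> w = (\<Sum>i<d. v $ i * w $ i)"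
  by (simp add: scalar_prod_def atLeast0LessThan)

lemma vnorm_eq_L2_set: "v \<in> carrier_vec d \<Longrightarrow> vnorm v = L2_set (\<lambda>i. v $ i) {..<d}"
  by (simp add: vnorm_def L2_set_def scalar_prod_sum[of v d] power2_eq_square)

lemma vnorm_power2: "v \<in> carrier_vec d \<Longrightarrow> (vnorm v)\<^sup>2 = (\<Sum>i<d. (v $ i)\<^sup>2)"
  by (simp add: vnorm_eq_L2_set[of v d] L2_set_power2)

lemma vnorm_append_le:
  assumes "u \<in> carrier_vec d" "v \<in> carrier_vec e"
  shows "vnorm (u @\<^sub>v v) \<le> vnorm u + vnorm v"
proof -
  have "0 \<le> u \<bullet> u" "0 \<le> v \<bullet> v"
    using assms by (simp_all add: scalar_prod_sum[of _ d] scalar_prod_sum[of _ e] sum_nonneg)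
  then show ?thesis
    using assms by (simp add: vnorm_def scalar_prod_append[of u d v e] sqrt_add_le_add_sqrt)
qed

lemma vec_converges_index:
  assumes "vec_converges d f l" "i < d"
  shows "(\<lambda>k. f k $ i) \<longlonglongrightarrow> l $ i"
proof -
  have c: "l \<in> carrier_vec d" "f k \<in> carrier_vec d" for k
    using assms(1) by (auto simp: vec_converges_def)
  have "\<bar>f k $ i - l $ i\<bar> \<le> vnorm (f k - l)" for k
  proof -
    have "\<bar>f k $ i - l $ i\<bar> \<le> L2_set (\<lambda>i. \<bar>f k $ i - l $ i\<bar>) {..<d}"
      using \<open>i < d\<close> by (intro member_le_L2_set) auto
    also have "\<dots> = vnorm (f k - l)"
      using c by (subst vnorm_eq_L2_set[of _ d]) (auto simp: L2_set_def)
    finally show ?thesis .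
  qed
  then have "norm (f k $ i - l $ i) \<le> norm (vnorm (f k - l)) * 1" for k
    by (metis abs_ge_self mult.right_neutral order_trans real_norm_def)
  then have "\<forall>\<^sub>F k in sequentially. norm (f k $ i - l $ i) \<le> norm (vnorm (f k - l)) * 1"
    by (intro always_eventually allI)
  moreover have "(\<lambda>k. vnorm (f k - l)) \<longlonglongrightarrow> 0"
    using assms(1) by (simp only: vec_converges_def)
  ultimately have "(\<lambda>k. f k $ i - l $ i) \<longlonglongrightarrow> 0"
    by (rule tendsto_0_le[rotated])
  then show ?thesis
    by (simp add: LIM_zero_iff)
qed

text \<open>\<open>proj\<close> picks some minimizer, so uniqueness is required as well. The
  inequality \<open>le\<close> keeps the squared distance to the candidate as an extra term and thus
  yields optimality and uniqueness at once.\<close>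

lemma proj_nonneg_orthant:
  assumes "v \<in> carrier_vec d"
  shows "proj (nonneg_orthant d) v = vec d (\<lambda>i. max 0 (v $ i))" (is "_ = ?p")
proof -
  have le: "(vnorm (v - ?p))\<^sup>2 + (\<Sum>i<d. (q $ i - ?p $ i)\<^sup>2) \<le> (vnorm (v - q))\<^sup>2"
    if "q \<in> nonneg_orthant d" for q
  proof -
    have q: "q \<in> carrier_vec d" "\<And>i. i < d \<Longrightarrow> 0 \<le> q $ i"
      using that by (auto simp: nonneg_orthant_def)
    have "(v $ i - max 0 (v $ i))\<^sup>2 + (q $ i - max 0 (v $ i))\<^sup>2 \<le> (v $ i - q $ i)\<^sup>2" if "i < d" for i
    proof (cases "0 \<le> v $ i")
      case True
      then show ?thesis by (simp add: power2_commute)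
    next
      case False
      then have "0 \<le> - (v $ i) * q $ i"
        using q(2)[OF that] by (intro mult_nonneg_nonneg) auto
      then show ?thesis
        using False by (simp add: max_def power2_eq_square algebra_simps)
    qed
    then have "(\<Sum>i<d. (v $ i - max 0 (v $ i))\<^sup>2 + (q $ i - max 0 (v $ i))\<^sup>2)
        \<le> (\<Sum>i<d. (v $ i - q $ i)\<^sup>2)"
      by (intro sum_mono) simp
    then show ?thesis
      using assms q(1) by (simp add: vnorm_power2[of _ d] sum.distrib)
  qed
  have le': "vnorm (v - ?p) \<le> vnorm (v - q)" if "q \<in> nonneg_orthant d" for q
  proof (rule power2_le_imp_le)
    have "0 \<le> (\<Sum>i<d. (q $ i - ?p $ i)\<^sup>2)"
      by (intro sum_nonneg) simp
    then show "(vnorm (v - ?p))\<^sup>2 \<le> (vnorm (v - q))\<^sup>2"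
      using le[OF that] by linarith
    have "q \<in> carrier_vec d"
      using that by (simp add: nonneg_orthant_def)
    then show "0 \<le> vnorm (v - q)"
      using assms by (simp add: vnorm_eq_L2_set[of _ d])
  qed
  let ?f = "\<lambda>p. vnorm (v - p)" and ?P = "\<lambda>p. p \<in> nonneg_orthant d"
  have p: "?p \<in> nonneg_orthant d"
    by (simp add: nonneg_orthant_def)
  then have "is_arg_min ?f ?P ?p"
    using le' by (auto simp: is_arg_min_def not_less)
  then have am: "is_arg_min ?f ?P (proj (nonneg_orthant d) v)" (is "is_arg_min _ _ ?q")
    unfolding proj_def arg_min_def by (rule someI)
  then have q: "?q \<in> nonneg_orthant d" and "?f ?q \<le> ?f ?p"
    using p by (auto simp: is_arg_min_def not_less)
  then have "?f ?q = ?f ?p"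
    using le'[OF q] by linarith
  then have "(\<Sum>i<d. (?q $ i - ?p $ i)\<^sup>2) \<le> 0"
    using le[OF q] by simp
  then have "(\<Sum>i<d. (?q $ i - ?p $ i)\<^sup>2) = 0"
    by (intro order.antisym sum_nonneg) auto
  then have "\<forall>i\<in>{..<d}. (?q $ i - ?p $ i)\<^sup>2 = 0"
    by (subst (asm) sum_nonneg_eq_0_iff) auto
  then show ?thesis
    using q by (intro eq_vecI) (auto simp: nonneg_orthant_def)
qed

section \<open>The splitting steps\<close>

lemma linear_coeff_eq_0:
  fixes L Q :: real
  assumes "\<And>t. 0 \<le> t * L + t\<^sup>2 * Q" "0 \<le> Q"
  shows "L = 0"
proof -
  \<comment> \<open>The test value is \<open>t = - u\<close>, where the form equals
    \<open>- u\<^sup>2\<close>. The denominator \<open>Q + 1\<close> stays positive even for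
    \<open>Q = 0\<close>.\<close>
  define u where "u = L / (Q + 1)"
  have L: "L = u * (Q + 1)"
    using assms(2) by (simp add: u_def)
  have "(- u) * L + (- u)\<^sup>2 * Q = - u\<^sup>2"
    by (simp add: L power2_eq_square algebra_simps)
  then have "u\<^sup>2 \<le> 0"
    using assms(1)[of "- u"] by linarith
  then show ?thesis
    by (simp add: L)
qed

text \<open>The analysis treats a general linear program in standard form; the transport data are
  substituted at the end.\<close>

locale kkt_system =
  fixes A :: "real mat" and b c :: "real vec" and \<sigma> :: real and r N :: nat
  assumes A [simp]: "A \<in> carrier_mat r N" and b [simp]: "b \<in> carrier_vec r"
    and c [simp]: "c \<in> carrier_vec N" and \<sigma>: "0 < \<sigma>"
begin

lemma dims [simp]: "dim_row A = r" "dim_col A = N" "dim_vec b = r" "dim_vec c = N"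
  using carrier_matD[OF A] carrier_vecD[OF b] carrier_vecD[OF c] by auto

definition slack :: "real vec \<Rightarrow> real vec \<Rightarrow> real vec" where
  "slack y z = A\<^sup>T *\<^sub>v y + z - c"

text \<open>The optimality conditions of the two minimization steps of the algorithm;
  with vanishing slack they are the KKT conditions.\<close>

definition half_kkt :: "real vec \<Rightarrow> real vec \<Rightarrow> real vec \<Rightarrow> bool" where
  "half_kkt y z x \<longleftrightarrow> y \<in> carrier_vec r \<and> z \<in> carrier_vec N \<and> x \<in> carrier_vec N \<and> A *\<^sub>v x = b \<and>
     (\<forall>i<N. 0 \<le> z $ i \<and> 0 \<le> x $ i + \<sigma> * slack y z $ i \<and> z $ i * (x $ i + \<sigma> * slack y z $ i) = 0)"

lemma transpose_mult_carrier [simp]: "A\<^sup>T *\<^sub>v y \<in> carrier_vec N"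
  by (intro carrier_vecI) simp

lemma slack_carrier [simp]: "z \<in> carrier_vec N \<Longrightarrow> slack y z \<in> carrier_vec N"
  by (simp add: slack_def)

lemma slack_index:
  "z \<in> carrier_vec N \<Longrightarrow> i < N \<Longrightarrow> slack y z $ i = (A\<^sup>T *\<^sub>v y) $ i + z $ i - c $ i"
  by (simp add: slack_def carrier_vecD del: index_mult_mat_vec)

lemma sum_transpose_mult:
  assumes "y \<in> carrier_vec r" "x \<in> carrier_vec N"
  shows "(\<Sum>i<N. (A\<^sup>T *\<^sub>v y) $ i * x $ i) = y \<bullet> (A *\<^sub>v x)"
  using transpose_vec_mult_scalar[OF A assms(2,1)] assms
  by (simp add: scalar_prod_sum[of x N] del: index_mult_mat_vec)

text \<open>Stationarity of the quadratic in \<open>y\<close>: its gradient is \<open>A\<close>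
  applied to the updated multiplier, minus \<open>b\<close>. The constant \<open>C\<close> stands
  for the term of the Lagrangian in \<open>x\<close> alone.\<close>

lemma y_step:
  assumes min: "is_arg_min (\<lambda>v. - (b \<bullet> v) + \<sigma> / 2 * (vnorm (A\<^sup>T *\<^sub>v v + z - c + (1 / \<sigma>) \<cdot>\<^sub>v x))\<^sup>2 - C)
      (\<lambda>v. v \<in> carrier_vec r) y"
    and [simp]: "z \<in> carrier_vec N" "x \<in> carrier_vec N"
  shows "A *\<^sub>v (x + \<sigma> \<cdot>\<^sub>v (A\<^sup>T *\<^sub>v y + z - c)) = b"
proof -
  let ?x' = "x + \<sigma> \<cdot>\<^sub>v (A\<^sup>T *\<^sub>v y + z - c)"
  \<comment> \<open>The primal residual itself is the perturbation direction, so the directional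
    derivative at \<open>y\<close> is its squared norm.\<close>
  let ?d = "A *\<^sub>v ?x' - b"
  let ?g = "A\<^sup>T *\<^sub>v y + z - c + (1 / \<sigma>) \<cdot>\<^sub>v x" and ?e = "A\<^sup>T *\<^sub>v ?d"
  note dim_zx [simp] = carrier_vecD[OF assms(2)] carrier_vecD[OF assms(3)]
  have y [simp]: "y \<in> carrier_vec r"
    using min by (simp add: is_arg_min_def)
  have x' [simp]: "?x' \<in> carrier_vec N"
    by (intro add_carrier_vec smult_carrier_vec minus_carrier_vec) simp_all
  have Ax' [simp]: "A *\<^sub>v ?x' \<in> carrier_vec r"
    by (intro carrier_vecI) simp
  have d [simp]: "?d \<in> carrier_vec r"
    by (intro minus_carrier_vec) simp_all
  have g [simp]: "?g \<in> carrier_vec N"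
    by (intro add_carrier_vec smult_carrier_vec minus_carrier_vec) simp_all
  \<comment> \<open>The vector inside the norm is the updated multiplier divided by \<sigma>; this
    identifies the derivative of the penalty term.\<close>
  have x'_g: "?x' $ i = \<sigma> * ?g $ i" if "i < N" for i
    using that \<sigma> by (simp add: field_simps del: index_mult_mat_vec)
  have ge: "\<sigma> * (\<Sum>i<N. ?g $ i * ?e $ i) = ?d \<bullet> (A *\<^sub>v ?x')"
    unfolding sum_transpose_mult[OF d x', symmetric] sum_distrib_left
    by (intro sum.cong refl) (simp only: x'_g lessThan_iff mult_ac)
  have "?d \<bullet> ?d = 0"
  proof (rule linear_coeff_eq_0)
    fix t
    have y_d: "y + t \<cdot>\<^sub>v ?d \<in> carrier_vec r"
      by (intro add_carrier_vec smult_carrier_vec) simp_all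
    have "A\<^sup>T *\<^sub>v (y + t \<cdot>\<^sub>v ?d) + z - c + (1 / \<sigma>) \<cdot>\<^sub>v x = ?g + t \<cdot>\<^sub>v ?e"
    proof -
      have "A\<^sup>T *\<^sub>v (y + t \<cdot>\<^sub>v ?d) = A\<^sup>T *\<^sub>v y + t \<cdot>\<^sub>v ?e"
        by (subst mult_add_distrib_mat_vec[of _ N r])
          (auto intro!: mult_mat_vec[of _ N r] smult_carrier_vec)
      then show ?thesis
        by (intro eq_vecI) (simp_all del: index_mult_mat_vec)
    qed
    then have "(vnorm (A\<^sup>T *\<^sub>v (y + t \<cdot>\<^sub>v ?d) + z - c + (1 / \<sigma>) \<cdot>\<^sub>v x))\<^sup>2
        = (\<Sum>i<N. (?g $ i + t * ?e $ i)\<^sup>2)"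
      by (simp add: vnorm_power2[of _ N] carrier_vecD[OF g] del: index_mult_mat_vec)
    also have "\<dots> = (vnorm ?g)\<^sup>2 + 2 * t * (\<Sum>i<N. ?g $ i * ?e $ i) + t\<^sup>2 * (\<Sum>i<N. (?e $ i)\<^sup>2)"
      unfolding vnorm_power2[OF g] sum_distrib_left sum.distrib[symmetric]
      by (intro sum.cong refl) (simp add: power2_eq_square algebra_simps del: index_mult_mat_vec)
    finally have "\<sigma> / 2 * (vnorm (A\<^sup>T *\<^sub>v (y + t \<cdot>\<^sub>v ?d) + z - c + (1 / \<sigma>) \<cdot>\<^sub>v x))\<^sup>2
        = \<sigma> / 2 * (vnorm ?g)\<^sup>2 + t * (\<sigma> * (\<Sum>i<N. ?g $ i * ?e $ i))
          + t\<^sup>2 * (\<sigma> / 2 * (\<Sum>i<N. (?e $ i)\<^sup>2))"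
      by (simp add: algebra_simps)
    moreover have "b \<bullet> (y + t \<cdot>\<^sub>v ?d) = b \<bullet> y + t * (b \<bullet> ?d)"
      by (subst scalar_prod_add_distrib[of _ r]) (auto intro!: smult_carrier_vec)
    moreover have "- (b \<bullet> y) + \<sigma> / 2 * (vnorm ?g)\<^sup>2 - C
        \<le> - (b \<bullet> (y + t \<cdot>\<^sub>v ?d))
          + \<sigma> / 2 * (vnorm (A\<^sup>T *\<^sub>v (y + t \<cdot>\<^sub>v ?d) + z - c + (1 / \<sigma>) \<cdot>\<^sub>v x))\<^sup>2 - C"
      using min y_d unfolding is_arg_min_def not_less[symmetric] by blast
    moreover have "?d \<bullet> ?d = ?d \<bullet> (A *\<^sub>v ?x') - b \<bullet> ?d"
      by (subst comm_scalar_prod[OF b d], subst scalar_prod_minus_distrib[of _ r]) simp_all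
    moreover from this have "t * (?d \<bullet> ?d) = t * (?d \<bullet> (A *\<^sub>v ?x')) - t * (b \<bullet> ?d)"
      by (simp only: right_diff_distrib)
    ultimately show "0 \<le> t * (?d \<bullet> ?d) + t\<^sup>2 * (\<sigma> / 2 * (\<Sum>i<N. (?e $ i)\<^sup>2))"
      unfolding ge by linarith
  next
    show "0 \<le> \<sigma> / 2 * (\<Sum>i<N. (?e $ i)\<^sup>2)"
      using \<sigma> by (intro mult_nonneg_nonneg sum_nonneg) auto
  qed
  then have "(\<Sum>i<r. ?d $ i * ?d $ i) = 0"
    by (simp only: scalar_prod_sum[OF d])
  then have "\<forall>i\<in>{..<r}. ?d $ i * ?d $ i = 0"
    by (subst (asm) sum_nonneg_eq_0_iff) auto
  then have "(A *\<^sub>v ?x') $ i - b $ i = 0" if "i < r" for i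
    using that by (simp del: index_mult_mat_vec)
  then show ?thesis
    by (intro eq_vecI) (simp_all del: index_mult_mat_vec)
qed

text \<open>The problem separates into minimizing \<open>(g + t)\<^sup>2\<close> over t \<ge> 0 in
  each coordinate. The minimizer is the negative part of \<open>g\<close>, and the multiplier
  \<open>x + \<sigma> * slack\<close> is \<sigma> times its positive part, whence
  complementarity.\<close>

lemma z_step:
  fixes C :: real
  assumes min: "is_arg_min
      (\<lambda>v. ereal (C + \<sigma> / 2 * (vnorm (A\<^sup>T *\<^sub>v y + v - c + (1 / \<sigma>) \<cdot>\<^sub>v x))\<^sup>2 - C')
        + indicator_fun (nonneg_orthant N) v)
      (\<lambda>v. v \<in> carrier_vec N) z"
    and [simp]: "x \<in> carrier_vec N" and i: "i < N"
  shows "0 \<le> z $ i" "0 \<le> x $ i + \<sigma> * slack y z $ i" "z $ i * (x $ i + \<sigma> * slack y z $ i) = 0"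
proof -
  let ?f = "\<lambda>v. C + \<sigma> / 2 * (vnorm (A\<^sup>T *\<^sub>v y + v - c + (1 / \<sigma>) \<cdot>\<^sub>v x))\<^sup>2 - C'"
  have z [simp]: "z \<in> carrier_vec N"
    using min by (simp add: is_arg_min_def)
  have z_nonneg: "z \<in> nonneg_orthant N"
  \<comment> \<open>Outside the orthant the objective is infinite, while it is finite at the zero
    vector.\<close>
  proof (rule ccontr)
    assume "z \<notin> nonneg_orthant N"
    moreover have "0\<^sub>v N \<in> nonneg_orthant N"
      by (simp add: nonneg_orthant_def)
    moreover have "0\<^sub>v N \<in> carrier_vec N"
      by simp
    ultimately show False
      using min unfolding is_arg_min_def indicator_fun_def by fastforce
  qed
  then show zi: "0 \<le> z $ i"
    using i by (simp add: nonneg_orthant_def)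
  define g where "g = (A\<^sup>T *\<^sub>v y) $ i - c $ i + x $ i / \<sigma>"
  have f_le: "?f z \<le> ?f v" if "v \<in> nonneg_orthant N" for v
    using min that z_nonneg unfolding is_arg_min_def indicator_fun_def not_less
    by (auto simp: nonneg_orthant_def)
  have sq_le: "(g + z $ i)\<^sup>2 \<le> (g + t)\<^sup>2" if "0 \<le> t" for t
  proof -
    \<comment> \<open>Only coordinate \<open>i\<close> is changed, so all other summands of the
      squared norm cancel.\<close>
    define v where "v = vec N (\<lambda>j. if j = i then t else z $ j)"
    have v: "v \<in> carrier_vec N"
      by (simp add: v_def)
    have "v \<in> nonneg_orthant N"
      using that z_nonneg by (simp add: v_def nonneg_orthant_def)
    from f_le[OF this]
    have le: "(vnorm (A\<^sup>T *\<^sub>v y + z - c + (1 / \<sigma>) \<cdot>\<^sub>v x))\<^sup>2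
        \<le> (vnorm (A\<^sup>T *\<^sub>v y + v - c + (1 / \<sigma>) \<cdot>\<^sub>v x))\<^sup>2"
      using \<sigma> by simp
    define h where "h u j = ((A\<^sup>T *\<^sub>v y) $ j + u $ j - c $ j + x $ j / \<sigma>)\<^sup>2" for u j
    have h: "(vnorm (A\<^sup>T *\<^sub>v y + u - c + (1 / \<sigma>) \<cdot>\<^sub>v x))\<^sup>2 = (\<Sum>j<N. h u j)"
      if [simp]: "u \<in> carrier_vec N" for u
      by (subst vnorm_power2[of _ N])
        (auto simp: h_def carrier_vecD[OF assms(2)] carrier_vecD[OF that]
          intro!: sum.cong simp del: index_mult_mat_vec)
    have "(\<Sum>j<N. h z j) \<le> (\<Sum>j<N. h v j)"
      using le by (simp only: h[OF z] h[OF v])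
    then have "h z i + (\<Sum>j\<in>{..<N} - {i}. h z j) \<le> h v i + (\<Sum>j\<in>{..<N} - {i}. h v j)"
      using i by (subst (asm) (1 2) sum.remove[of _ i]) auto
    moreover have "(\<Sum>j\<in>{..<N} - {i}. h z j) = (\<Sum>j\<in>{..<N} - {i}. h v j)"
      by (intro sum.cong refl) (auto simp: h_def v_def)
    ultimately have "h z i \<le> h v i"
      by simp
    then show ?thesis
      using i by (simp add: h_def v_def g_def algebra_simps del: index_mult_mat_vec)
  qed
  have z_eq: "z $ i = max 0 (- g)"
  proof (cases "0 \<le> g")
    case True
    have "(g + z $ i)\<^sup>2 \<le> g\<^sup>2"
      using sq_le[of 0] by simp
    then have "g + z $ i \<le> g"
      using True by (rule power2_le_imp_le)
    then show ?thesis
      using zi True by simp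
  next
    case False
    then have "(g + z $ i)\<^sup>2 \<le> 0"
      using sq_le[of "- g"] by simp
    then show ?thesis
      using False by simp
  qed
  have p: "x $ i + \<sigma> * slack y z $ i = \<sigma> * (g + z $ i)"
    using \<sigma> i by (simp add: slack_index g_def field_simps del: index_mult_mat_vec)
  show "0 \<le> x $ i + \<sigma> * slack y z $ i"
    unfolding p using \<sigma> z_eq by (intro mult_nonneg_nonneg) auto
  show "z $ i * (x $ i + \<sigma> * slack y z $ i) = 0"
    unfolding p using z_eq by (auto simp: max_def)
qed

text \<open>Firm nonexpansiveness, the residual being -\<sigma> times the slack. With p = x +
  \<sigma> * slack and u = \<open>A\<^sup>T *\<^sub>v y\<close>, the sum splits into -\<sigma><dp,
  dz> and -\<sigma><dx, du>, where d denotes differences. Complementarity makes the first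
  nonnegative; the second vanishes because \<open>x\<close> and \<open>x'\<close> are both
  feasible.\<close>

lemma half_kkt_monotone:
  assumes "half_kkt y z x" "half_kkt y' z' x'"
  shows "0 \<le> (\<Sum>i<N. ((x $ i + \<sigma> * z $ i) - (x' $ i + \<sigma> * z' $ i))
                     * (- \<sigma> * slack y z $ i - (- \<sigma> * slack y' z' $ i)))"
proof -
  let ?u = "\<lambda>i. (A\<^sup>T *\<^sub>v y) $ i" and ?u' = "\<lambda>i. (A\<^sup>T *\<^sub>v y') $ i"
  let ?p = "\<lambda>i. x $ i + \<sigma> * slack y z $ i" and ?p' = "\<lambda>i. x' $ i + \<sigma> * slack y' z' $ i"
  have [simp]: "y \<in> carrier_vec r" "z \<in> carrier_vec N" "x \<in> carrier_vec N" "A *\<^sub>v x = b"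
    "y' \<in> carrier_vec r" "z' \<in> carrier_vec N" "x' \<in> carrier_vec N" "A *\<^sub>v x' = b"
    using assms by (auto simp: half_kkt_def)
  have orth: "(\<Sum>i<N. (x $ i - x' $ i) * (?u i - ?u' i)) = 0"
  proof -
    have "(\<Sum>i<N. (x $ i - x' $ i) * (?u i - ?u' i))
        = ((\<Sum>i<N. ?u i * x $ i) - (\<Sum>i<N. ?u i * x' $ i))
          - ((\<Sum>i<N. ?u' i * x $ i) - (\<Sum>i<N. ?u' i * x' $ i))"
      unfolding sum_subtractf[symmetric] by (intro sum.cong refl) (simp only: algebra_simps)
    also have "\<dots> = 0"
      by (simp add: sum_transpose_mult del: index_mult_mat_vec)
    finally show ?thesis .
  qed
  have "(\<Sum>i<N. ((x $ i + \<sigma> * z $ i) - (x' $ i + \<sigma> * z' $ i))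
                * (- \<sigma> * slack y z $ i - (- \<sigma> * slack y' z' $ i)))
      = (\<Sum>i<N. - \<sigma> * ((?p i - ?p' i) * (z $ i - z' $ i))
                - \<sigma> * ((x $ i - x' $ i) * (?u i - ?u' i)))"
    by (intro sum.cong refl) (simp add: slack_index algebra_simps del: index_mult_mat_vec)
  also have "\<dots> = (\<Sum>i<N. - \<sigma> * ((?p i - ?p' i) * (z $ i - z' $ i)))"
    unfolding sum_subtractf sum_distrib_left[symmetric] orth by simp
  also have "\<dots> \<ge> 0"
  proof (intro sum_nonneg)
    fix i assume "i \<in> {..<N}"
    then have "0 \<le> ?p i" "0 \<le> ?p' i" "0 \<le> z $ i" "0 \<le> z' $ i" "z $ i * ?p i = 0" "z' $ i * ?p' i = 0"
      using assms by (auto simp: half_kkt_def)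
    moreover from this have "0 \<le> ?p i * z' $ i" "0 \<le> ?p' i * z $ i"
      by (auto intro!: mult_nonneg_nonneg simp del: index_mult_mat_vec)
    moreover have "(?p i - ?p' i) * (z $ i - z' $ i)
        = z $ i * ?p i - ?p i * z' $ i - ?p' i * z $ i + z' $ i * ?p' i"
      by (simp only: algebra_simps)
    ultimately have "(?p i - ?p' i) * (z $ i - z' $ i) \<le> 0"
      by linarith
    then show "0 \<le> - \<sigma> * ((?p i - ?p' i) * (z $ i - z' $ i))"
      using \<sigma> by (simp only: mult_minus_left neg_0_le_iff_le) (simp only: mult_le_0_iff, simp)
  qed
  finally show ?thesis .
qed

text \<open>All conditions in \<open>half_kkt\<close> are equations or weak inequalities between
  continuous coordinate functions, hence closed under limits.\<close>

lemma half_kkt_limit: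
  assumes h: "\<And>k. half_kkt (yb k) (zb k) (xb k)"
    and y: "vec_converges r yb ys" and z: "vec_converges N zb zs" and x: "vec_converges N xb xs"
  shows "half_kkt ys zs xs" and "\<And>i. i < N \<Longrightarrow> (\<lambda>k. slack (yb k) (zb k) $ i) \<longlonglongrightarrow> slack ys zs $ i"
proof -
  have [simp]: "ys \<in> carrier_vec r" "zs \<in> carrier_vec N" "xs \<in> carrier_vec N"
    "yb k \<in> carrier_vec r" "zb k \<in> carrier_vec N" "xb k \<in> carrier_vec N" for k
    using y z x by (auto simp: vec_converges_def)
  have mv: "(B *\<^sub>v v) $ i = (\<Sum>j<d. B $$ (i, j) * v $ j)"
    if "B \<in> carrier_mat e d" "v \<in> carrier_vec d" "i < e" for B :: "real mat" and v d e i
    using that by (simp add: scalar_prod_sum[of v d])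
  have mv_lim: "(\<lambda>k. (B *\<^sub>v f k) $ i) \<longlonglongrightarrow> (B *\<^sub>v l) $ i"
    if "B \<in> carrier_mat e d" "vec_converges d f l" "i < e" for B :: "real mat" and f l d e i
  proof -
    have "l \<in> carrier_vec d" "f k \<in> carrier_vec d" for k
      using that(2) by (auto simp: vec_converges_def)
    then show ?thesis
      using that vec_converges_index[OF that(2)]
      by (auto simp: mv[of B e d] simp del: index_mult_mat_vec intro!: tendsto_intros)
  qed
  have zi: "(\<lambda>k. zb k $ i) \<longlonglongrightarrow> zs $ i" and xi: "(\<lambda>k. xb k $ i) \<longlonglongrightarrow> xs $ i" if "i < N" for i
    using vec_converges_index[OF z that] vec_converges_index[OF x that] by auto
  show slack: "(\<lambda>k. slack (yb k) (zb k) $ i) \<longlonglongrightarrow> slack ys zs $ i" if "i < N" for i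
    unfolding slack_index[OF \<open>zs \<in> _\<close> that] slack_index[OF \<open>zb _ \<in> _\<close> that]
    using that by (intro tendsto_intros mv_lim[of _ N r] y zi) simp_all
  note p = tendsto_add[OF xi tendsto_mult[OF tendsto_const[of \<sigma>] slack]]
  have "A *\<^sub>v xs = b"
  proof (intro eq_vecI)
    fix i assume "i < dim_vec b"
    then have "i < r"
      using carrier_vecD[OF b] by simp
    from mv_lim[OF A x this] have "(\<lambda>k. b $ i) \<longlonglongrightarrow> (A *\<^sub>v xs) $ i"
      using h by (simp add: half_kkt_def del: index_mult_mat_vec)
    then show "(A *\<^sub>v xs) $ i = b $ i"
      using LIMSEQ_unique tendsto_const by blast
  qed simp
  moreover have "0 \<le> zs $ i" if "i < N" for i
    using h that by (intro LIMSEQ_le_const[OF zi[OF that]]) (auto simp: half_kkt_def)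
  moreover have "0 \<le> xs $ i + \<sigma> * slack ys zs $ i" if "i < N" for i
    using h that by (intro LIMSEQ_le_const[OF p[OF that that]]) (auto simp: half_kkt_def)
  moreover have "zs $ i * (xs $ i + \<sigma> * slack ys zs $ i) = 0" if "i < N" for i
  proof -
    have "(\<lambda>k. zb k $ i * (xb k $ i + \<sigma> * slack (yb k) (zb k) $ i))
        \<longlonglongrightarrow> zs $ i * (xs $ i + \<sigma> * slack ys zs $ i)"
      by (intro tendsto_mult[OF zi[OF that] p[OF that that]])
    then have "(\<lambda>k. 0) \<longlonglongrightarrow> zs $ i * (xs $ i + \<sigma> * slack ys zs $ i)"
      using h that by (simp add: half_kkt_def del: mult_eq_0_iff)
    then show ?thesis
      using LIMSEQ_unique tendsto_const by blast
  qed
  ultimately show "half_kkt ys zs xs"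
    by (simp add: half_kkt_def)
qed

text \<open>In coordinates the left vector is min(z, x). Complementarity says min(z, x + \<sigma> *
  slack) = 0, and changing one argument of min by \<sigma> * slack changes its value by at most that
  much.\<close>

lemma vnorm_minus_proj_le:
  assumes "half_kkt y z x"
  shows "vnorm (z - proj (nonneg_orthant N) (z - x)) \<le> \<sigma> * vnorm (slack y z)"
proof -
  have [simp]: "z \<in> carrier_vec N" "x \<in> carrier_vec N"
    using assms by (auto simp: half_kkt_def)
  note dim_zx [simp] = carrier_vecD[OF this(1)] carrier_vecD[OF this(2)]
  have "vnorm (z - proj (nonneg_orthant N) (z - x)) = L2_set (\<lambda>i. \<bar>z $ i - max 0 (z $ i - x $ i)\<bar>) {..<N}"
    by (subst vnorm_eq_L2_set[of _ N]) (auto simp: proj_nonneg_orthant[of _ N] L2_set_def intro!: sum.cong)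
  also have "\<dots> \<le> L2_set (\<lambda>i. \<bar>\<sigma> * slack y z $ i\<bar>) {..<N}"
  proof (intro L2_set_mono)
    fix i assume "i \<in> {..<N}"
    then have "0 \<le> z $ i" "0 \<le> x $ i + \<sigma> * slack y z $ i" "z $ i = 0 \<or> x $ i + \<sigma> * slack y z $ i = 0"
      using assms by (auto simp: half_kkt_def)
    then show "\<bar>z $ i - max 0 (z $ i - x $ i)\<bar> \<le> \<bar>\<sigma> * slack y z $ i\<bar>"
      by linarith
  qed simp
  also have "\<dots> = \<sigma> * vnorm (slack y z)"
    using \<sigma> by (simp add: vnorm_eq_L2_set[of _ N] L2_set_right_distrib) (simp add: L2_set_def)
  finally show ?thesis .
qed

text \<open>The dual equation expresses \<open>c\<close> through the limit for the lower bound and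
  through the current point for the upper one. Its \<open>A\<^sup>T\<close> part is orthogonal to
  \<open>x - xs\<close>, as both points are feasible; signs and complementarity handle the
  rest.\<close>

lemma objective_gap:
  assumes h: "half_kkt y z x" and hs: "half_kkt ys zs xs"
    and opt: "\<And>i. i < N \<Longrightarrow> slack ys zs $ i = 0"
  shows "- \<sigma> * vnorm zs * vnorm (slack y z) \<le> c \<bullet> (x - xs)"
    and "c \<bullet> (x - xs) \<le> vnorm (slack y z)
      * (L2_set (\<lambda>i. (x $ i + \<sigma> * z $ i) - (xs $ i + \<sigma> * zs $ i)) {..<N} + \<sigma> * vnorm zs)"
proof -
  have [simp]: "y \<in> carrier_vec r" "z \<in> carrier_vec N" "x \<in> carrier_vec N" "A *\<^sub>v x = b"
    "ys \<in> carrier_vec r" "zs \<in> carrier_vec N" "xs \<in> carrier_vec N" "A *\<^sub>v xs = b"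
    using h hs by (auto simp: half_kkt_def)
  define s where "s i = slack y z $ i" for i
  have pos: "0 \<le> z $ i" "0 \<le> x $ i + \<sigma> * s i" "z $ i * (x $ i + \<sigma> * s i) = 0"
    "0 \<le> zs $ i" "0 \<le> xs $ i" "zs $ i * xs $ i = 0" if "i < N" for i
    using h hs opt[OF that] that by (auto simp: half_kkt_def s_def)
  have vn: "vnorm (slack y z) = L2_set s {..<N}" "vnorm zs = L2_set (\<lambda>i. zs $ i) {..<N}"
    by (simp_all add: vnorm_eq_L2_set[of _ N] s_def[abs_def])
  have dual: "(\<Sum>i<N. (A\<^sup>T *\<^sub>v v) $ i * (x $ i - xs $ i)) = 0" if "v \<in> carrier_vec r" for v
    using sum_transpose_mult[OF that \<open>x \<in> _\<close>] sum_transpose_mult[OF that \<open>xs \<in> _\<close>]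
    by (simp add: right_diff_distrib sum_subtractf del: index_mult_mat_vec)
  have gap: "c \<bullet> (x - xs) = (\<Sum>i<N. c $ i * (x $ i - xs $ i))"
    by (subst scalar_prod_sum[of _ N]) (auto simp: carrier_vecD[OF \<open>xs \<in> _\<close>] intro!: sum.cong)
  have "c \<bullet> (x - xs) = (\<Sum>i<N. (A\<^sup>T *\<^sub>v ys) $ i * (x $ i - xs $ i)) + (\<Sum>i<N. zs $ i * (x $ i - xs $ i))"
    unfolding gap sum.distrib[symmetric]
  proof (intro sum.cong refl)
    fix i assume "i \<in> {..<N}"
    then have "c $ i = (A\<^sup>T *\<^sub>v ys) $ i + zs $ i"
      using opt[of i] by (simp add: slack_index del: index_mult_mat_vec)
    then show "c $ i * (x $ i - xs $ i)
        = (A\<^sup>T *\<^sub>v ys) $ i * (x $ i - xs $ i) + zs $ i * (x $ i - xs $ i)"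
      by (simp only: distrib_right)
  qed
  also have "\<dots> = (\<Sum>i<N. zs $ i * (x $ i - xs $ i))"
    by (simp only: dual[OF \<open>ys \<in> _\<close>] add_0)
  also have "\<dots> \<ge> (\<Sum>i<N. - \<sigma> * (zs $ i * s i))"
  proof (intro sum_mono)
    fix i assume "i \<in> {..<N}"
    then have "0 \<le> zs $ i * (x $ i + \<sigma> * s i)" "zs $ i * xs $ i = 0"
      using pos[of i] by (auto simp del: mult_eq_0_iff)
    then show "- \<sigma> * (zs $ i * s i) \<le> zs $ i * (x $ i - xs $ i)"
      by (simp only: algebra_simps)
  qed
  finally have "- \<sigma> * (\<Sum>i<N. zs $ i * s i) \<le> c \<bullet> (x - xs)"
    by (simp only: sum_distrib_left)
  moreover have "\<sigma> * (\<Sum>i<N. zs $ i * s i) \<le> \<sigma> * (vnorm zs * vnorm (slack y z))"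
    unfolding vn using \<sigma> by (intro mult_left_mono sum_mult_le_L2_set) simp
  ultimately show "- \<sigma> * vnorm zs * vnorm (slack y z) \<le> c \<bullet> (x - xs)"
    by (simp add: mult.assoc)
  let ?w = "\<lambda>i. (x $ i + \<sigma> * z $ i) - (xs $ i + \<sigma> * zs $ i)"
  have "c \<bullet> (x - xs)
      = (\<Sum>i<N. (A\<^sup>T *\<^sub>v y) $ i * (x $ i - xs $ i)) + (\<Sum>i<N. (z $ i - s i) * (x $ i - xs $ i))"
    unfolding gap sum.distrib[symmetric]
  proof (intro sum.cong refl)
    fix i assume "i \<in> {..<N}"
    then have "c $ i = (A\<^sup>T *\<^sub>v y) $ i + (z $ i - s i)"
      by (simp add: slack_index s_def del: index_mult_mat_vec)
    then show "c $ i * (x $ i - xs $ i)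
        = (A\<^sup>T *\<^sub>v y) $ i * (x $ i - xs $ i) + (z $ i - s i) * (x $ i - xs $ i)"
      by (simp only: distrib_right)
  qed
  also have "\<dots> = (\<Sum>i<N. (z $ i - s i) * (x $ i - xs $ i))"
    by (simp only: dual[OF \<open>y \<in> _\<close>] add_0)
  \<comment> \<open>Regrouped around \<open>?w\<close>, because the Halpern analysis bounds the
    distance of the combination x + \<sigma> z, not that of \<open>x\<close> alone.\<close>
  also have "\<dots> \<le> (\<Sum>i<N. s i * - ?w i + \<sigma> * (s i * - zs $ i))"
  proof (intro sum_mono)
    fix i assume "i \<in> {..<N}"
    then have "0 \<le> z $ i * xs $ i" "z $ i * (x $ i + \<sigma> * s i) = 0"
      using pos[of i] by (auto simp del: mult_eq_0_iff)
    moreover have "(z $ i - s i) * (x $ i - xs $ i)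
        = z $ i * (x $ i + \<sigma> * s i) - z $ i * xs $ i + s i * - ?w i + \<sigma> * (s i * - zs $ i)"
      by (simp add: algebra_simps)
    ultimately show "(z $ i - s i) * (x $ i - xs $ i) \<le> s i * - ?w i + \<sigma> * (s i * - zs $ i)"
      by linarith
  qed
  also have "\<dots> = (\<Sum>i<N. s i * - ?w i) + \<sigma> * (\<Sum>i<N. s i * - zs $ i)"
    by (simp only: sum.distrib sum_distrib_left)
  also have "\<dots> \<le> L2_set s {..<N} * L2_set (\<lambda>i. - ?w i) {..<N}
      + \<sigma> * (L2_set s {..<N} * L2_set (\<lambda>i. - zs $ i) {..<N})"
    using \<sigma> by (intro add_mono mult_left_mono sum_mult_le_L2_set) simp
  also have "\<dots> = vnorm (slack y z) * (L2_set ?w {..<N} + \<sigma> * vnorm zs)"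
    unfolding vn L2_set_uminus by (simp only: distrib_left mult_ac)
  finally show "c \<bullet> (x - xs) \<le> vnorm (slack y z) * (L2_set ?w {..<N} + \<sigma> * vnorm zs)" .
qed

end

section \<open>Convergence rates\<close>

locale hot_run = kkt_system +
  fixes z x yb zb xb :: "nat \<Rightarrow> real vec"
  assumes z_carrier [simp]: "\<And>k. z k \<in> carrier_vec N"
    and x_carrier [simp]: "\<And>k. x k \<in> carrier_vec N"
    and half_kkt: "\<And>k. half_kkt (yb k) (zb k) (xb k)"
    and xb: "\<And>k. xb k = x k + \<sigma> \<cdot>\<^sub>v (A\<^sup>T *\<^sub>v yb k + z k - c)"
    and z_Suc: "\<And>k. z (Suc k) = halpern_update k (z 0) (z k) (zb k)"
    and x_Suc: "\<And>k. x (Suc k) = halpern_update k (x 0) (x k) (xb k)"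
begin

abbreviation v :: "nat \<Rightarrow> nat \<Rightarrow> real" where
  "v k i \<equiv> x k $ i + \<sigma> * z k $ i"

abbreviation vb :: "nat \<Rightarrow> nat \<Rightarrow> real" where
  "vb k i \<equiv> xb k $ i + \<sigma> * zb k $ i"

lemma bar_carrier [simp]:
  "yb k \<in> carrier_vec r" "zb k \<in> carrier_vec N" "xb k \<in> carrier_vec N"
  using half_kkt[of k] by (auto simp: half_kkt_def)

text \<open>The multiplier update contains the old \<open>z k\<close>; adding \<sigma> times the
  change from \<open>z k\<close> to \<open>zb k\<close> turns it into the slack at the barred
  point.\<close>

lemma residual_eq_slack:
  assumes "i < N"
  shows "v k i - vb k i = - \<sigma> * slack (yb k) (zb k) $ i"
  using assms
  by (simp add: xb slack_index carrier_vecD[OF x_carrier] carrier_vecD[OF z_carrier] algebra_simps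
      del: index_mult_mat_vec)

lemma halpern_update_index:
  assumes "u0 \<in> carrier_vec N" "u \<in> carrier_vec N" "ub \<in> carrier_vec N" "i < N"
  shows "(real k + 2) * halpern_update k u0 u ub $ i = u0 $ i + (real k + 1) * (2 * ub $ i - u $ i)"
proof -
  have "halpern_update k u0 u ub $ i
      = 1 / (real k + 2) * u0 $ i + (real k + 1) / (real k + 2) * (2 * ub $ i - u $ i)"
    using assms(4)
    by (simp add: halpern_update_def carrier_vecD[OF assms(1)] carrier_vecD[OF assms(2)]
        carrier_vecD[OF assms(3)] add.commute)
  moreover have "real k + 2 \<noteq> 0"
    by linarith
  ultimately show ?thesis
    by (simp add: distrib_left)
qed

text \<open>The recursion is linear, so it passes from \<open>x\<close> and \<open>z\<close> to
  \<open>v\<close>; firmness is \<open>half_kkt_monotone\<close> at consecutive barred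
  points.\<close>

sublocale halpern "{..<N}" v vb
proof
  fix k i assume "i \<in> {..<N}"
  then have xz: "(real k + 2) * x (Suc k) $ i = x 0 $ i + (real k + 1) * (2 * xb k $ i - x k $ i)"
    "(real k + 2) * z (Suc k) $ i = z 0 $ i + (real k + 1) * (2 * zb k $ i - z k $ i)"
    by (simp_all add: x_Suc z_Suc halpern_update_index)
  have "(real k + 2) * v (Suc k) i
      = (real k + 2) * x (Suc k) $ i + \<sigma> * ((real k + 2) * z (Suc k) $ i)"
    by (simp only: distrib_left mult.left_commute)
  also have "\<dots> = v 0 i + (real k + 1) * (2 * vb k i - v k i)"
    unfolding xz by (simp add: algebra_simps)
  finally show "(real k + 2) * v (Suc k) i = v 0 i + (real k + 1) * (2 * vb k i - v k i)" .
next
  fix k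
  have "(\<Sum>i<N. (vb (Suc k) i - vb k i) * ((v (Suc k) i - vb (Suc k) i) - (v k i - vb k i)))
      = (\<Sum>i<N. (vb (Suc k) i - vb k i)
          * (- \<sigma> * slack (yb (Suc k)) (zb (Suc k)) $ i - (- \<sigma> * slack (yb k) (zb k) $ i)))"
    by (intro sum.cong refl) (simp only: residual_eq_slack lessThan_iff)
  then show "0 \<le> (\<Sum>i<N. (vb (Suc k) i - vb k i) * ((v (Suc k) i - vb (Suc k) i) - (v k i - vb k i)))"
    using half_kkt_monotone[OF half_kkt half_kkt] by simp
qed

lemma L2_residual: "L2_set (\<lambda>i. v k i - vb k i) {..<N} = \<sigma> * vnorm (slack (yb k) (zb k))"
proof -
  have "L2_set (\<lambda>i. v k i - vb k i) {..<N} = L2_set (\<lambda>i. - (\<sigma> * slack (yb k) (zb k) $ i)) {..<N}"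
    by (intro L2_set_cong refl) (simp only: residual_eq_slack lessThan_iff mult_minus_left)
  then show ?thesis
    using \<sigma> by (simp add: L2_set_right_distrib vnorm_eq_L2_set[of _ N])
qed

section \<open>Rates against the limit of the barred iterates\<close>

context
  fixes ys zs xs :: "real vec"
  assumes lim: "vec_converges r yb ys" "vec_converges N zb zs" "vec_converges N xb xs"
begin

lemma half_kkt_lim: "half_kkt ys zs xs"
  by (rule half_kkt_limit(1)[OF half_kkt lim])

text \<open>Optimality of the limit comes for free: the residual estimate needs only boundedness of the
  barred iterates, so no solution has to be known beforehand.\<close>

lemma slack_lim: "i < N \<Longrightarrow> slack ys zs $ i = 0"
proof -
  assume i: "i < N"
  have "(\<lambda>k. L2_set (\<lambda>i. v k i - vb k i) {..<N}) \<longlonglongrightarrow> 0"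
    by (rule residual_tendsto_0[of "\<lambda>i. xs $ i + \<sigma> * zs $ i"])
      (auto intro!: tendsto_intros vec_converges_index[OF lim(2)] vec_converges_index[OF lim(3)])
  then have "(\<lambda>k. \<sigma> * slack (yb k) (zb k) $ i) \<longlonglongrightarrow> 0"
  proof (rule tendsto_0_le[where K = 1], intro always_eventually allI)
    fix k
    have "\<bar>v k i - vb k i\<bar> \<le> L2_set (\<lambda>i. \<bar>v k i - vb k i\<bar>) {..<N}"
      using i by (intro member_le_L2_set) auto
    then show "norm (\<sigma> * slack (yb k) (zb k) $ i) \<le> norm (L2_set (\<lambda>i. v k i - vb k i) {..<N}) * 1"
      by (simp add: residual_eq_slack[OF i] L2_set_def abs_mult)
  qed
  moreover have "(\<lambda>k. \<sigma> * slack (yb k) (zb k) $ i) \<longlonglongrightarrow> \<sigma> * slack ys zs $ i"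
    by (intro tendsto_intros half_kkt_limit(2)[OF half_kkt lim i])
  ultimately have "\<sigma> * slack ys zs $ i = 0"
    using LIMSEQ_unique by blast
  then show ?thesis
    using \<sigma> by simp
qed

text \<open>Monotonicity between the current barred point and the limit, where the slack of the
  limit drops out.\<close>

lemma fixpoint_lim:
  "0 \<le> (\<Sum>i<N. (vb k i - (xs $ i + \<sigma> * zs $ i)) * (v k i - vb k i))"
proof -
  have "(\<Sum>i<N. (vb k i - (xs $ i + \<sigma> * zs $ i)) * (v k i - vb k i))
      = (\<Sum>i<N. (vb k i - (xs $ i + \<sigma> * zs $ i))
          * (- \<sigma> * slack (yb k) (zb k) $ i - (- \<sigma> * slack ys zs $ i)))"
    by (intro sum.cong refl) (simp only: residual_eq_slack slack_lim lessThan_iff mult_zero_right diff_zero)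
  then show ?thesis
    using half_kkt_monotone[OF half_kkt[of k] half_kkt_lim] by simp
qed

abbreviation R0 :: real where
  "R0 \<equiv> L2_set (\<lambda>i. v 0 i - (xs $ i + \<sigma> * zs $ i)) {..<N}"

lemma slack_rate: "\<sigma> * vnorm (slack (yb k) (zb k)) \<le> R0 / (real k + 1)"
  using residual_rate[OF fixpoint_lim] by (simp only: L2_residual)

text \<open>The primal block vanishes, the dual block is minus the slack, and the projection block
  is at most \<sigma> times its norm. Hence the factor \<sigma> + 1, divided by \<sigma> because the
  rate is for \<sigma> times the slack.\<close>

lemma kkt_residual_rate:
  "vnorm ((b - A *\<^sub>v xb k) @\<^sub>v (zb k - proj (nonneg_orthant N) (zb k - xb k)) @\<^sub>v (c - A\<^sup>T *\<^sub>v yb k - zb k))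
    \<le> (\<sigma> + 1) / \<sigma> * (R0 / (real k + 1))"
proof -
  let ?s = "vnorm (slack (yb k) (zb k))"
  have "c - A\<^sup>T *\<^sub>v yb k - zb k = - slack (yb k) (zb k)"
    by (intro eq_vecI) (simp_all add: slack_def carrier_vecD[OF bar_carrier(2)] del: index_mult_mat_vec)
  then have s: "vnorm (c - A\<^sup>T *\<^sub>v yb k - zb k) = ?s"
    by (simp add: vnorm_eq_L2_set[of _ N] carrier_vecD[OF slack_carrier[OF bar_carrier(2)]] L2_set_def)
  have b0: "vnorm (b - A *\<^sub>v xb k) = 0"
    using half_kkt[of k] by (simp add: half_kkt_def vnorm_def scalar_prod_def)
  have p: "zb k - proj (nonneg_orthant N) (zb k - xb k) \<in> carrier_vec N"
    by (simp add: proj_nonneg_orthant[of _ N] minus_carrier_vec)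
  have "vnorm ((b - A *\<^sub>v xb k) @\<^sub>v (zb k - proj (nonneg_orthant N) (zb k - xb k)) @\<^sub>v (c - A\<^sup>T *\<^sub>v yb k - zb k))
      \<le> vnorm (b - A *\<^sub>v xb k) + (vnorm (zb k - proj (nonneg_orthant N) (zb k - xb k))
        + vnorm (c - A\<^sup>T *\<^sub>v yb k - zb k))"
    by (intro order_trans[OF vnorm_append_le[of _ r _ "N + N"]] add_left_mono vnorm_append_le[of _ N _ N]
        append_carrier_vec p minus_carrier_vec) (auto intro!: carrier_vecI)
  also have "\<dots> \<le> \<sigma> * ?s + ?s"
    using vnorm_minus_proj_le[OF half_kkt[of k]] by (simp add: b0 s)
  also have "\<dots> = (\<sigma> + 1) / \<sigma> * (\<sigma> * ?s)"
    using \<sigma> by (simp add: field_simps)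
  also have "\<dots> \<le> (\<sigma> + 1) / \<sigma> * (R0 / (real k + 1))"
    using \<sigma> by (intro mult_left_mono slack_rate) auto
  finally show ?thesis .
qed

lemma objective_rate:
  shows "- vnorm zs * (R0 / (real k + 1)) \<le> c \<bullet> (xb k - xs)"
    and "c \<bullet> (xb k - xs) \<le> (\<sigma> * vnorm zs + R0) * (R0 / (\<sigma> * (real k + 1)))"
proof -
  let ?s = "vnorm (slack (yb k) (zb k))"
  have zs: "zs \<in> carrier_vec N"
    using lim(2) by (simp add: vec_converges_def)
  have nonneg: "0 \<le> vnorm zs"
    by (simp add: vnorm_eq_L2_set[OF zs])
  have "vnorm zs * (\<sigma> * ?s) \<le> vnorm zs * (R0 / (real k + 1))"
    by (intro mult_left_mono slack_rate nonneg)
  moreover have "- \<sigma> * vnorm zs * ?s = - (vnorm zs * (\<sigma> * ?s))"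
    by simp
  ultimately show "- vnorm zs * (R0 / (real k + 1)) \<le> c \<bullet> (xb k - xs)"
    using objective_gap(1)[OF half_kkt[of k] half_kkt_lim slack_lim]
    unfolding mult_minus_left[of "vnorm zs"] by linarith
  have "c \<bullet> (xb k - xs)
      \<le> ?s * (L2_set (\<lambda>i. vb k i - (xs $ i + \<sigma> * zs $ i)) {..<N} + \<sigma> * vnorm zs)"
    by (rule objective_gap(2)[OF half_kkt[of k] half_kkt_lim slack_lim])
  also have "\<dots> \<le> R0 / (\<sigma> * (real k + 1)) * (R0 + \<sigma> * vnorm zs)"
  proof (intro mult_mono add_right_mono)
    have "?s \<le> R0 / (real k + 1) / \<sigma>"
      using slack_rate[of k] \<sigma> by (simp add: pos_le_divide_eq mult_ac)
    then show "?s \<le> R0 / (\<sigma> * (real k + 1))"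
      by (simp only: divide_divide_eq_left mult.commute)
    show "L2_set (\<lambda>i. vb k i - (xs $ i + \<sigma> * zs $ i)) {..<N} \<le> R0"
      by (rule bar_dist_le[OF fixpoint_lim])
  qed (use \<sigma> nonneg in simp_all)
  finally show "c \<bullet> (xb k - xs) \<le> (\<sigma> * vnorm zs + R0) * (R0 / (\<sigma> * (real k + 1)))"
    by (simp only: mult.commute add.commute)
qed

end

end

section \<open>Dimensions of the transport data and the final theorem\<close>

lemma dim_row_diag_block_mat_replicate:
  "dim_row (diag_block_mat (replicate k P @ [Q])) = k * dim_row P + dim_row Q"
  by (simp_all add: dim_diag_block_mat sum_list_replicate)

text \<open>Positivity matters for truncated subtraction: \<open>A4\<close> has \<open>n - 1\<close>
  blocks of \<open>m\<close> rows and one of \<open>m - 1\<close>, and the row counts must add up to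
  \<open>3 * (m * n) - 1\<close>.\<close>

lemma A_mat_carrier:
  assumes "0 < m" "0 < n"
  shows "A_mat m n \<in> carrier_mat (rowdim m n) (coldim m n)"
proof
  have "0 < m * n"
    using assms by simp
  moreover have "dim_row (A4 m n) = m * n - 1"
    using assms unfolding A4_def dim_row_diag_block_mat_replicate
    by (cases n) (auto simp: kron_def ones_row_def Ibar_def add.commute mult.commute)
  ultimately show "dim_row (A_mat m n) = rowdim m n"
    by (simp add: A_mat_def four_block_mat_def Let_def append_rows_def A1_def kron_def ones_row_def rowdim_def)
  show "dim_col (A_mat m n) = coldim m n"
    by (simp add: A_mat_def four_block_mat_def Let_def append_rows_def A1_def kron_def ones_row_def coldim_def
        power2_eq_square)
qed

lemma b_vec_carrier:
  assumes "0 < m" "0 < n" "\<mu>1 \<in> carrier_vec (m * n)"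
  shows "b_vec m n \<mu>1 \<mu>2 \<in> carrier_vec (rowdim m n)"
proof -
  have "0 < m * n"
    using assms by simp
  then show ?thesis
    by (intro carrier_vecI) (simp add: b_vec_def rowdim_def Ibar_def carrier_vecD[OF assms(3)])
qed

lemma c_vec_carrier: "c_vec m n \<in> carrier_vec (coldim m n)"
  by (simp add: c_vec_def c1_vec_def c2_vec_def coldim_def carrier_vecI)

lemma halpern_update_carrier [simp]:
  "u \<in> carrier_vec d \<Longrightarrow> halpern_update k u0 u ub \<in> carrier_vec d"
  by (intro carrier_vecI) (simp add: halpern_update_def carrier_vecD[of u d])

theorem proposition3:
  fixes m n :: nat and \<mu>1 \<mu>2 :: "real vec" and \<sigma> R0 :: real
    and y0 z0 x0 ys zs xs :: "real vec"
    and y z x yb zb xb :: "nat \<Rightarrow> real vec"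
  assumes "0 < m" and "0 < n"
    and "histogram (m * n) \<mu>1" and "histogram (m * n) \<mu>2"
    and "0 < \<sigma>"
    and "y0 \<in> carrier_vec (rowdim m n)"
    and "z0 \<in> carrier_vec (coldim m n)"
    and "x0 \<in> carrier_vec (coldim m n)"
    and "HOT_sequence m n \<mu>1 \<mu>2 \<sigma> y0 z0 x0 y z x yb zb xb"
    and "vec_converges (rowdim m n) yb ys"
    and "vec_converges (coldim m n) zb zs"
    and "vec_converges (coldim m n) xb xs"
    and "R0 = vnorm ((x0 - xs) + \<sigma> \<cdot>\<^sub>v (z0 - zs))"
  shows "\<forall>k. vnorm (KKT_res m n \<mu>1 \<mu>2 (yb k) (zb k) (xb k)) \<le> (\<sigma> + 1) / \<sigma> * (R0 / real (k + 1))
    \<and> - vnorm zs * (R0 / real (k + 1)) \<le> c_vec m n \<bullet> (xb k - xs)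
    \<and> c_vec m n \<bullet> (xb k - xs) \<le> (\<sigma> * vnorm zs + R0) * (R0 / (\<sigma> * real (k + 1)))"
proof -
  let ?A = "A_mat m n" and ?b = "b_vec m n \<mu>1 \<mu>2" and ?c = "c_vec m n"
  let ?r = "rowdim m n" and ?N = "coldim m n"
  have "\<mu>1 \<in> carrier_vec (m * n)"
    using assms(3) by (simp add: histogram_def nonneg_orthant_def)
  then interpret kkt_system ?A ?b ?c \<sigma> ?r ?N
    using assms(1,2,5) by unfold_locales (simp_all add: A_mat_carrier b_vec_carrier c_vec_carrier)
  note lim = assms(10,11,12)
  have bar [simp]: "yb k \<in> carrier_vec ?r" "zb k \<in> carrier_vec ?N" "xb k \<in> carrier_vec ?N" for k
    using lim by (auto simp: vec_converges_def)
  have init: "z 0 = z0" "x 0 = x0"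
    and y_min: "\<And>k. is_arg_min (\<lambda>v. aug_lag_smooth m n \<mu>1 \<mu>2 \<sigma> v (z k) (x k))
          (\<lambda>v. v \<in> carrier_vec ?r) (yb k)"
    and xb: "\<And>k. xb k = x k + \<sigma> \<cdot>\<^sub>v (?A\<^sup>T *\<^sub>v yb k + z k - ?c)"
    and z_min: "\<And>k. is_arg_min (\<lambda>v. aug_lag m n \<mu>1 \<mu>2 \<sigma> (yb k) v (xb k))
          (\<lambda>v. v \<in> carrier_vec ?N) (zb k)"
    and Suc: "\<And>k. z (Suc k) = halpern_update k z0 (z k) (zb k)"
      "\<And>k. x (Suc k) = halpern_update k x0 (x k) (xb k)"
    using assms(9) unfolding HOT_sequence_def by blast+
  have zk: "z k \<in> carrier_vec ?N" and xk: "x k \<in> carrier_vec ?N" for k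
    by (induction k) (simp_all add: init Suc assms(7,8))
  have "half_kkt (yb k) (zb k) (xb k)" for k
  proof -
    have "?A *\<^sub>v xb k = ?b"
      using y_step[OF y_min[unfolded aug_lag_smooth_def] zk xk] by (simp only: xb[symmetric])
    then show ?thesis
      using z_step[OF z_min[unfolded aug_lag_def aug_lag_smooth_def] bar(3)]
      by (simp add: half_kkt_def)
  qed
  then interpret hot_run ?A ?b ?c \<sigma> ?r ?N z x yb zb xb
    using zk xk xb Suc by unfold_locales (simp_all only: init)
  have xs: "xs \<in> carrier_vec ?N" and zs: "zs \<in> carrier_vec ?N"
    using lim by (auto simp: vec_converges_def)
  \<comment> \<open>The given radius is the distance of \<open>v 0\<close> to the limit of
    \<open>vb\<close>, after regrouping coordinates.\<close>
  have "R0 = L2_set (\<lambda>i. v 0 i - (xs $ i + \<sigma> * zs $ i)) {..<?N}"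
    unfolding assms(13)
    by (subst vnorm_eq_L2_set[of _ ?N])
      (auto intro!: L2_set_cong minus_carrier_vec smult_carrier_vec add_carrier_vec
        simp: init xs zs assms(7,8) carrier_vecD[OF xs] carrier_vecD[OF zs] algebra_simps)
  moreover have "real (k + 1) = real k + 1" for k
    by simp
  ultimately show ?thesis
    using kkt_residual_rate[OF lim] objective_rate[OF lim] by (simp only: KKT_res_def) blast
qed

end
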